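(* Let $f=\frac1n\sum_{i=1}^nf_i$ where each $f_i:\mathbb{R}^d\to\mathbb{R}$ is proper, closed, convex, differentiable and $L_i$-smooth, $f$ is $L$-smooth and attains its minimum, and there is $x_*\in\mathbb{R}^d$ with $\nabla f_i(x_* )=0$ for all $i$ (interpolation). Let $\gamma>0$ and assume $M^\gamma$ satisfies the Polyak–Łojasiewicz condition with constant $\mu_\gamma^+>0$: $$\tfrac12\|\nabla M^\gamma(x)\|^2\ge\mu_\gamma^+\big(M^\gamma(x)-M^\gamma(x_* )\big)\quad\text{for all }x\in\mathbb{R}^d.$$ Let $L_\gamma>0$ be a smoothness constant of $M^\gamma$, let $\delta\ge0$, and let $(x_k)$ be the iterates of inexact FedExProx with full participation, $$x_{k+1}=x_k+\alpha\left(\frac1n\sum_{i=1}^n\mathrm{prox}^\delta_{\gamma f_i}(x_k)-x_k\right),\qquad \alpha\gamma=\frac{1}{2L_\gamma}.$$ Then for every $K\ge0$ $$\|x_K-\Pi(x_K)\|^2\le\left(1-\frac{\mu_\gamma^+}{8L_\gamma}\right)^K\|x_0-\Pi(x_0)\|^2+\frac{20\,\delta}{(\mu_\gamma^+)^2\gamma^2},$$ and hence $$f(x_K)-f(\Pi(x_K))\le\frac L2\left(1-\frac{\mu_\gamma^+}{8L_\gamma}\right)^K\|x_0-\Pi(x_0)\|^2+\frac{10L\,\delta}{(\mu_\gamma^+)^2\gamma^2}.$$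
   Context: A function is $L$-smooth if its gradient is $L$-Lipschitz. For a convex function $g$ and $\gamma>0$, $\mathrm{prox}_{\gamma g}(x)=\arg\min_z\{g(z)+\frac1{2\gamma}\|z-x\|^2\}$ and $M_g^\gamma(x)=\min_z\{g(z)+\frac1{2\gamma}\|z-x\|^2\}$ (Moreau envelope). $M^\gamma=\frac1n\sum_{i=1}^nM^\gamma_{f_i}$. The inexact proximal operator $\mathrm{prox}^\delta_{\gamma g}(x)$ denotes any vector with $\|\mathrm{prox}^\delta_{\gamma g}(x)-\mathrm{prox}_{\gamma g}(x)\|^2\le\delta$. $\mathcal{X}_*=\{x:\nabla f_i(x)=0\ \forall i\}$ and $\Pi$ is the Euclidean projection onto $\mathcal{X}_*$. *)

theory Defs
  imports "HOL-Analysis.Analysis"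
begin

text \<open>
  Only meaningful where \<open>f\<close> is differentiable; the gradient there is unique, and in a
  Euclidean space it exists wherever the Frechet derivative does.
\<close>
definition gradient :: "('a::euclidean_space \<Rightarrow> real) \<Rightarrow> 'a \<Rightarrow> 'a"
  where "gradient f x = (THE D. GDERIV f x :> D)"

text \<open>The library's Lipschitz predicate includes \<open>L \<ge> 0\<close>.\<close>
definition smooth_with :: "real \<Rightarrow> ('a::euclidean_space \<Rightarrow> real) \<Rightarrow> bool"
  where "smooth_with L f \<longleftrightarrow> f differentiable_on UNIV \<and> L-lipschitz_on UNIV (gradient f)"

definition prox :: "real \<Rightarrow> ('a::euclidean_space \<Rightarrow> real) \<Rightarrow> 'a \<Rightarrow> 'a"
  where "prox \<gamma> g x = arg_min (\<lambda>z. g z + 1 / (2 * \<gamma>) * (norm (z - x))\<^sup>2) (\<lambda>z. True)"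

text \<open>
  For convex \<open>g\<close> and \<open>\<gamma> > 0\<close> the infimum is finite and attained, so it is the minimum.
\<close>
definition moreau_env :: "real \<Rightarrow> ('a::euclidean_space \<Rightarrow> real) \<Rightarrow> 'a \<Rightarrow> real"
  where "moreau_env \<gamma> g x = (INF z. g z + 1 / (2 * \<gamma>) * (norm (z - x))\<^sup>2)"

text \<open>
  The inexact proximal operator is a relation: any \<open>p\<close> close enough to the exact
  proximal point is admissible.
\<close>
definition inexact_prox ::
    "real \<Rightarrow> real \<Rightarrow> ('a::euclidean_space \<Rightarrow> real) \<Rightarrow> 'a \<Rightarrow> 'a \<Rightarrow> bool"
  where "inexact_prox \<delta> \<gamma> g x p \<longleftrightarrow> (norm (p - prox \<gamma> g x))\<^sup>2 \<le> \<delta>"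

definition avg_fun :: "nat \<Rightarrow> (nat \<Rightarrow> 'a \<Rightarrow> real) \<Rightarrow> 'a \<Rightarrow> real"
  where "avg_fun n f x = 1 / real n * (\<Sum>i=1..n. f i x)"

definition avg_moreau :: "nat \<Rightarrow> real \<Rightarrow> (nat \<Rightarrow> 'a::euclidean_space \<Rightarrow> real) \<Rightarrow> 'a \<Rightarrow> real"
  where "avg_moreau n \<gamma> f = avg_fun n (\<lambda>i. moreau_env \<gamma> (f i))"

definition common_crit :: "nat \<Rightarrow> (nat \<Rightarrow> 'a::euclidean_space \<Rightarrow> real) \<Rightarrow> 'a set"
  where "common_crit n f = {x. \<forall>i\<in>{1..n}. gradient (f i) x = 0}"

definition proj_crit :: "nat \<Rightarrow> (nat \<Rightarrow> 'a::euclidean_space \<Rightarrow> real) \<Rightarrow> 'a \<Rightarrow> 'a"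
  where "proj_crit n f x = closest_point (common_crit n f) x"

end

theory Submission
  imports Defs
begin

text \<open>
  The gradient of \<open>moreau_env \<gamma> g\<close> at \<open>x\<close> is \<open>(x - prox \<gamma> g x) / \<gamma>\<close>, so the iteration is gradient
  descent on the averaged envelope \<open>M\<close> with step \<open>\<alpha> \<gamma> = 1 / (2 L\<gamma>)\<close> and gradient error of squared
  norm at most \<open>\<delta> / \<gamma>\<^sup>2\<close>. Interpolation makes the minimisers of \<open>M\<close> the common critical points, and
  the PL condition yields quadratic growth \<open>\<mu> / 2 * dist\<^sup>2 \<le> M - min M\<close>, hence a perturbed contraction of
  the squared distance. If \<open>M\<close> is constant then \<open>\<mu> \<le> L\<gamma>\<close> may fail, but then all distances vanish.
\<close>

section \<open>Gradients, convexity and smoothness\<close>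

lemma gradient_eqI: "GDERIV f x :> D \<Longrightarrow> gradient f x = D"
  unfolding gradient_def
proof (rule the_equality)
  fix E assume "GDERIV f x :> E" "GDERIV f x :> D"
  then have "(\<lambda>h. inner h E) = (\<lambda>h. inner h D)"
    unfolding gderiv_def by (rule has_derivative_unique)
  then show "E = D" by (simp add: fun_eq_iff vector_eq_ldot)
qed

text \<open>Riesz representation: a linear functional \<open>f'\<close> is the inner product with
  \<open>adjoint f' 1\<close>.\<close>

lemma GDERIV_gradient:
  assumes "f differentiable at x"
  shows "GDERIV f x :> gradient f x"
proof -
  obtain f' where f': "(f has_derivative f') (at x)"
    using assms differentiable_def by blast
  then have "linear f'" by (rule has_derivative_linear)
  then have "f' = (\<lambda>h. inner h (adjoint f' 1))"
    by (simp add: adjoint_works)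
  with f' have D: "GDERIV f x :> adjoint f' 1"
    unfolding gderiv_def by metis
  then show ?thesis by (simp add: gradient_eqI[OF D])
qed

lemma smooth_with_GDERIV: "smooth_with L f \<Longrightarrow> GDERIV f x :> gradient f x"
  by (simp add: GDERIV_gradient smooth_with_def differentiable_on_def)

lemma GDERIV_line:
  assumes "GDERIV f (a + t *\<^sub>R v) :> D"
  shows "((\<lambda>s. f (a + s *\<^sub>R v)) has_real_derivative inner v D) (at t)"
proof -
  have "((\<lambda>s. a + s *\<^sub>R v) has_derivative (\<lambda>s. s *\<^sub>R v)) (at t)"
    by (auto intro!: derivative_eq_intros)
  then have "((\<lambda>s. f (a + s *\<^sub>R v)) has_derivative (\<lambda>s. inner (s *\<^sub>R v) D)) (at t)"
    using has_derivative_compose assms unfolding gderiv_def by blast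
  then show ?thesis
    by (simp add: has_field_derivative_def mult_commute_abs)
qed

text \<open>Convexity bounds every difference quotient on the segment towards \<open>y\<close> by
  \<open>f y - f x\<close>; the bound survives the limit at \<open>x\<close>.\<close>

lemma convex_on_above_gradient:
  assumes cvx: "convex_on UNIV f" and D: "GDERIV f x :> D"
  shows "f x + inner D (y - x) \<le> f y"
proof -
  have lim: "((\<lambda>t. (f (x + t *\<^sub>R (y - x)) - f x) / t) \<longlongrightarrow> inner (y - x) D) (at_right 0)"
    using GDERIV_line[of f x 0 "y - x" D] D
    by (auto simp: has_field_derivative_iff intro: filterlim_mono[OF _ order_refl at_le])
  have "\<forall>\<^sub>F t in at_right 0. (f (x + t *\<^sub>R (y - x)) - f x) / t \<le> f y - f x"
    using eventually_at_right_real[OF zero_less_one]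
  proof (rule eventually_mono)
    fix t :: real assume t: "t \<in> {0<..<1}"
    have "x + t *\<^sub>R (y - x) = (1 - t) *\<^sub>R x + t *\<^sub>R y"
      by (simp add: algebra_simps)
    then have "f (x + t *\<^sub>R (y - x)) \<le> (1 - t) * f x + t * f y"
      using convex_onD[OF cvx, of t x y] t by simp
    then show "(f (x + t *\<^sub>R (y - x)) - f x) / t \<le> f y - f x"
      using t by (simp add: field_simps)
  qed
  from tendsto_upperbound[OF lim this] show ?thesis
    by (simp add: inner_commute)
qed

text \<open>Descent lemma. \<open>\<phi>\<close> is \<open>f\<close> on the segment minus its
  quadratic upper model; by Cauchy-Schwarz and the Lipschitz bound its derivative is nonpositive on
  the unit interval.\<close>

lemma smooth_with_descent:
  assumes "smooth_with L f"
  shows "f y \<le> f x + inner (gradient f x) (y - x) + L / 2 * (norm (y - x))\<^sup>2"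
proof -
  define v where "v = y - x"
  let ?g = "\<lambda>t. gradient f (x + t *\<^sub>R v)"
  define \<phi> where "\<phi> t = f (x + t *\<^sub>R v) - t * inner v (gradient f x) - L / 2 * t\<^sup>2 * (norm v)\<^sup>2" for t
  have "\<phi> 1 \<le> \<phi> 0"
  proof (rule DERIV_nonpos_imp_nonincreasing[where f = \<phi>])
    show "(0::real) \<le> 1" by simp
    fix t :: real assume t: "0 \<le> t" "t \<le> 1"
    have der: "(\<phi> has_real_derivative inner v (?g t) - inner v (gradient f x) - L * t * (norm v)\<^sup>2) (at t)"
      unfolding \<phi>_def
      by (rule derivative_eq_intros GDERIV_line smooth_with_GDERIV[OF assms] refl | simp)+
    have "inner v (?g t) - inner v (gradient f x) \<le> norm v * norm (?g t - gradient f x)"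
      by (metis inner_diff_right norm_cauchy_schwarz)
    moreover have "norm (?g t - gradient f x) \<le> L * (t * norm v)"
      using lipschitz_onD[of L UNIV "gradient f" "x + t *\<^sub>R v" x] assms t
      by (simp add: smooth_with_def dist_norm)
    then have "norm v * norm (?g t - gradient f x) \<le> norm v * (L * (t * norm v))"
      by (rule mult_left_mono) simp
    ultimately have "inner v (?g t) - inner v (gradient f x) - L * t * (norm v)\<^sup>2 \<le> 0"
      by (simp add: power2_eq_square algebra_simps)
    with der show "\<exists>d. (\<phi> has_real_derivative d) (at t) \<and> d \<le> 0"
      by blast
  qed
  then show ?thesis
    by (simp add: \<phi>_def v_def inner_commute)
qed

text \<open>A gradient step of length \<open>1 / L\<close>, which minimises the quadratic upper
  model at \<open>x\<close>, cannot get below \<open>m\<close>.\<close>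

lemma smooth_with_gradient_le:
  assumes "smooth_with L f" "L > 0" and lower: "\<And>y. m \<le> f y"
  shows "(norm (gradient f x))\<^sup>2 \<le> 2 * L * (f x - m)"
proof -
  have "m \<le> f (x - (1 / L) *\<^sub>R gradient f x)" by (rule lower)
  also have "\<dots> \<le> f x - (norm (gradient f x))\<^sup>2 / (2 * L)"
    using smooth_with_descent[OF assms(1), of "x - (1 / L) *\<^sub>R gradient f x" x] \<open>L > 0\<close>
    by (simp add: power2_norm_eq_inner[symmetric] power_mult_distrib power_divide)
      (simp add: field_simps power2_eq_square)
  finally show ?thesis using \<open>L > 0\<close> by (simp add: field_simps)
qed

section \<open>Quadratic growth from the PL condition\<close>

text \<open>
  Ekeland's argument: if the claim fails, then \<open>h = sqrt (f - m)\<close> penalised by a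
  multiple \<open>c\<close> of the distance to \<open>x\<close>, with \<open>c\<close> below the lower bound \<open>sqrt (\<mu> / 2)\<close> for the slope of
  \<open>h\<close>, has a minimiser over the ball at which \<open>f > m\<close>, and there the slope of \<open>h\<close> is at most \<open>c\<close>.
\<close>
lemma PL_imp_quadratic_growth:
  fixes f :: "'a::euclidean_space \<Rightarrow> real"
  assumes deriv: "\<And>y. GDERIV f y :> g y"
    and lower: "\<And>y. m \<le> f y"
    and PL: "\<And>y. \<mu> * (f y - m) \<le> 1 / 2 * (norm (g y))\<^sup>2"
    and "\<mu> > 0" "d \<ge> 0"
    and far: "\<And>s. f s = m \<Longrightarrow> d \<le> norm (x - s)"
  shows "\<mu> / 2 * d\<^sup>2 \<le> f x - m"
proof (rule ccontr)
  assume neg: "\<not> ?thesis"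
  define h where "h y = sqrt (f y - m)" for y
  have "d > 0" using neg lower[of x] \<open>d \<ge> 0\<close> by (cases "d = 0") auto
  have "h x < sqrt (\<mu> / 2 * d\<^sup>2)"
    unfolding h_def using neg by (intro real_sqrt_less_mono) simp
  then have "h x / d < sqrt (\<mu> / 2)"
    using \<open>d > 0\<close> unfolding real_sqrt_mult by (simp add: divide_less_eq)
  \<comment> \<open>The first inequality keeps the penalised minimiser off the boundary of the ball;
    the second contradicts minimality through the slope.\<close>
  then obtain c where c: "h x / d < c" "c < sqrt (\<mu> / 2)"
    using dense by blast
  have "h x \<ge> 0" using lower by (simp add: h_def)
  then have "c > 0" using c(1) \<open>d > 0\<close> by (smt (verit) divide_nonneg_pos)
  have cont: "continuous_on UNIV f"
    using deriv
    by (meson continuous_at_imp_continuous_on gderiv_def has_derivative_continuous)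
  then have "continuous_on (cball x d) (\<lambda>y. h y + c * norm (y - x))"
    unfolding h_def by (intro continuous_intros continuous_on_subset[OF cont]) auto
  then obtain y where y: "y \<in> cball x d"
    and ymin: "\<And>z. z \<in> cball x d \<Longrightarrow> h y + c * norm (y - x) \<le> h z + c * norm (z - x)"
    using continuous_attains_inf[OF compact_cball] \<open>d > 0\<close>
    by (metis (no_types, lifting) cball_eq_empty not_less_iff_gr_or_eq)
  have hy0: "h y \<ge> 0" using lower by (simp add: h_def)
  \<comment> \<open>Comparison with the centre \<open>x\<close> places \<open>y\<close> strictly
    inside the ball, so \<open>far\<close> rules out \<open>f y = m\<close> and the square root is
    differentiable there.\<close>
  have "c * norm (y - x) \<le> h x"
    using ymin[of x] \<open>d > 0\<close> hy0 by simp
  also have "\<dots> < c * d" using c(1) \<open>d > 0\<close> by (simp add: divide_less_eq)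
  finally have near: "norm (y - x) < d" using \<open>c > 0\<close> by simp
  then have "f y \<noteq> m" using far[of y] by (auto simp: norm_minus_commute)
  then have fy: "f y > m" using lower[of y] by simp
  then have hy: "h y > 0" by (simp add: h_def)
  \<comment> \<open>Where \<open>f > m\<close> the gradient of \<open>h\<close> is
    \<open>g / (2 * h)\<close>, so PL says exactly that its norm is at least
    \<open>sqrt (\<mu> / 2)\<close>.\<close>
  have "2 * \<mu> * (h y)\<^sup>2 \<le> (norm (g y))\<^sup>2"
    using PL[of y] fy by (simp add: h_def)
  then have "sqrt (2 * \<mu> * (h y)\<^sup>2) \<le> norm (g y)"
    by (rule real_le_lsqrt[rotated 1]) simp_all
  moreover have "sqrt (2 * \<mu> * (h y)\<^sup>2) = 2 * h y * sqrt (\<mu> / 2)"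
  proof -
    have "2 * \<mu> * (h y)\<^sup>2 = (2 * h y)\<^sup>2 * (\<mu> / 2)" by (simp add: power2_eq_square)
    moreover have "sqrt ((2 * h y)\<^sup>2 * (\<mu> / 2)) = 2 * h y * sqrt (\<mu> / 2)"
      unfolding real_sqrt_mult[of "(2 * h y)\<^sup>2"] real_sqrt_abs using hy by simp
    ultimately show ?thesis by (simp only:)
  qed
  ultimately have slope: "2 * h y * c < norm (g y)"
    using mult_strict_left_mono[OF c(2), of "2 * h y"] hy by linarith
  then have gpos: "norm (g y) > 0"
    using hy \<open>c > 0\<close> by (smt (verit) mult_pos_pos)
  \<comment> \<open>For \<open>t \<ge> 0\<close>, \<open>\<psi>\<close> plus the constant
    \<open>c * norm (y - x)\<close> majorises the penalised objective along the steepest descent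
    ray, by the triangle inequality; the two agree at \<open>t = 0\<close>.\<close>
  define \<psi> where "\<psi> t = sqrt (f (y + t *\<^sub>R (- g y)) - m) + c * t * norm (g y)" for t
  have "((\<lambda>t. f (y + t *\<^sub>R (- g y)) - m) has_real_derivative inner (- g y) (g y)) (at 0)"
    using DERIV_diff[OF GDERIV_line[of f y 0 "- g y" "g y"] DERIV_const[of m]] deriv[of y] by simp
  then have "((\<lambda>t. sqrt (f (y + t *\<^sub>R (- g y)) - m)) has_real_derivative
      inverse (sqrt (f (y + 0 *\<^sub>R (- g y)) - m)) / 2 * inner (- g y) (g y)) (at 0)"
    using fy by (intro DERIV_chain2[OF DERIV_real_sqrt]) simp_all
  moreover have "((\<lambda>t. c * t * norm (g y)) has_real_derivative c * norm (g y)) (at 0)"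
    by (auto intro!: derivative_eq_intros)
  ultimately have "(\<psi> has_real_derivative inverse (h y) / 2 * inner (- g y) (g y) + c * norm (g y)) (at 0)"
    unfolding \<psi>_def h_def using DERIV_add by fastforce
  moreover have "inverse (h y) / 2 * inner (- g y) (g y) + c * norm (g y) < 0"
  proof -
    have "2 * h y * c * norm (g y) < norm (g y) * norm (g y)"
      using slope gpos by simp
    then show ?thesis
      using hy by (simp add: power2_norm_eq_inner[symmetric] field_simps power2_eq_square)
  qed
  ultimately obtain e where e: "e > 0" "\<And>t. 0 < t \<Longrightarrow> t < e \<Longrightarrow> \<psi> t < \<psi> 0"
    using DERIV_neg_dec_right[of \<psi> _ 0] unfolding add_0 by blast
  \<comment> \<open>The first bound keeps \<open>\<psi> t\<close> below \<open>\<psi> 0\<close>, the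
    second keeps the point in the ball.\<close>
  define t where "t = min (e / 2) ((d - norm (y - x)) / norm (g y))"
  have t: "0 < t" "t < e" using e near gpos by (auto simp: t_def)
  have tg: "t * norm (g y) \<le> d - norm (y - x)"
    using gpos by (simp add: t_def min_mult_distrib_right)
  let ?z = "y + t *\<^sub>R (- g y)"
  have z: "norm (?z - x) \<le> norm (y - x) + t * norm (g y)"
    using norm_triangle_ineq[of "y - x" "t *\<^sub>R (- g y)"] t(1) by (simp add: algebra_simps)
  then have "?z \<in> cball x d" using tg by (simp add: dist_norm norm_minus_commute)
  then have "h y + c * norm (y - x) \<le> h ?z + c * norm (?z - x)" by (rule ymin)
  also have "\<dots> \<le> h ?z + c * (norm (y - x) + t * norm (g y))"
    using z \<open>c > 0\<close> by simp
  finally have "\<psi> 0 \<le> \<psi> t" by (simp add: \<psi>_def h_def algebra_simps)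
  with e(2)[OF t] show False by simp
qed

section \<open>Proximal points and the Moreau envelope\<close>

text \<open>A minimiser exists by compactness of a large ball, outside which the quadratic term
  already outweighs \<open>f x - m\<close>. Once one exists, the choice made by
  \<open>arg_min\<close> is a minimiser.\<close>

lemma prox_minimizes:
  fixes f :: "'a::euclidean_space \<Rightarrow> real"
  assumes cont: "continuous_on UNIV f" and lower: "\<And>z. m \<le> f z" and "\<gamma> > 0"
  shows "f (prox \<gamma> f x) + 1 / (2 * \<gamma>) * (norm (prox \<gamma> f x - x))\<^sup>2 \<le> f z + 1 / (2 * \<gamma>) * (norm (z - x))\<^sup>2"
proof -
  let ?F = "\<lambda>z. f z + 1 / (2 * \<gamma>) * (norm (z - x))\<^sup>2"
  \<comment> \<open>The summand 1 gives \<open>R \<ge> 1\<close>, hence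
    \<open>R * R \<ge> R - 1 = 2 * \<gamma> * (f x - m)\<close>.\<close>
  define R where "R = 2 * \<gamma> * (f x - m) + 1"
  have R: "R \<ge> 1" using lower[of x] \<open>\<gamma> > 0\<close> by (simp add: R_def)
  have "continuous_on (cball x R) ?F"
    by (intro continuous_intros continuous_on_subset[OF cont]) auto
  moreover have "cball x R \<noteq> {}" using R by simp
  ultimately have "\<exists>p\<in>cball x R. \<forall>z\<in>cball x R. ?F p \<le> ?F z"
    by (intro continuous_attains_inf compact_cball)
  then obtain p where p: "\<And>z. z \<in> cball x R \<Longrightarrow> ?F p \<le> ?F z"
    by blast
  have "?F p \<le> ?F z" for z
  proof (cases "z \<in> cball x R")
    case False
    then have far: "R \<le> norm (z - x)" by (simp add: dist_norm norm_minus_commute)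
    have "R - 1 \<le> R * R" using R mult_left_mono[OF R, of R] by linarith
    also have "\<dots> \<le> (norm (z - x))\<^sup>2" using far R by (simp add: power2_eq_square mult_mono)
    finally have "f x - m \<le> 1 / (2 * \<gamma>) * (norm (z - x))\<^sup>2"
      using \<open>\<gamma> > 0\<close> by (simp add: R_def pos_le_divide_eq mult.commute)
    with lower[of z] p[of x] R show ?thesis by simp
  qed (rule p)
  then have "is_arg_min ?F (\<lambda>z. True) p" by (simp add: is_arg_min_linorder)
  then have "is_arg_min ?F (\<lambda>z. True) (prox \<gamma> f x)"
    unfolding prox_def arg_min_def by (rule someI)
  then show ?thesis by (simp add: is_arg_min_linorder)
qed

lemma moreau_env_le:
  assumes "\<And>z. m \<le> f z" "\<gamma> > 0"
  shows "moreau_env \<gamma> f x \<le> f z + 1 / (2 * \<gamma>) * (norm (z - x))\<^sup>2"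
  unfolding moreau_env_def
proof (rule cINF_lower)
  show "bdd_below (range (\<lambda>z. f z + 1 / (2 * \<gamma>) * (norm (z - x))\<^sup>2))"
    using assms by (intro bdd_belowI[of _ m]) (auto intro: add_increasing2)
qed simp

lemma moreau_env_eq_prox:
  fixes f :: "'a::euclidean_space \<Rightarrow> real"
  assumes "continuous_on UNIV f" "\<And>z. m \<le> f z" "\<gamma> > 0"
  shows "moreau_env \<gamma> f x = f (prox \<gamma> f x) + 1 / (2 * \<gamma>) * (norm (prox \<gamma> f x - x))\<^sup>2"
  by (rule antisym[OF moreau_env_le[OF assms(2,3)]])
    (auto simp: moreau_env_def intro!: cINF_greatest prox_minimizes[OF assms, simplified])

text \<open>First-order optimality: the derivative of the penalised objective vanishes at its
  minimiser.\<close>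

lemma prox_gradient:
  fixes f :: "'a::euclidean_space \<Rightarrow> real"
  assumes diff: "f differentiable_on UNIV" and lower: "\<And>z. m \<le> f z" and "\<gamma> > 0"
  shows "gradient f (prox \<gamma> f x) = (x - prox \<gamma> f x) /\<^sub>R \<gamma>"
proof -
  let ?p = "prox \<gamma> f x" and ?F = "\<lambda>z. f z + 1 / (2 * \<gamma>) * inner (z - x) (z - x)"
  have grad: "GDERIV f ?p :> gradient f ?p"
    using diff by (simp add: GDERIV_gradient differentiable_on_def)
  have "(?F has_derivative (\<lambda>h. inner h (gradient f ?p) + inner h (?p - x) / \<gamma>)) (at ?p)"
    by (rule derivative_eq_intros grad[unfolded gderiv_def] refl)+
      (simp add: inner_commute field_simps)
  moreover have "\<forall>z. ?F ?p \<le> ?F z"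
    using prox_minimizes[OF differentiable_imp_continuous_on[OF diff] lower \<open>\<gamma> > 0\<close>, of x]
    by (simp add: power2_norm_eq_inner)
  ultimately have "(\<lambda>h. inner h (gradient f ?p) + inner h (?p - x) / \<gamma>) = (\<lambda>h. 0)"
    by (intro has_derivative_local_min[of ?F]) auto
  then have "inner h (gradient f ?p + (?p - x) /\<^sub>R \<gamma>) = 0" for h
    by (auto simp: fun_eq_iff inner_add_right divide_inverse mult.commute)
  then have "gradient f ?p + (?p - x) /\<^sub>R \<gamma> = 0"
    using inner_eq_zero_iff by blast
  then show ?thesis
    by (simp add: add_eq_0_iff2 scaleR_diff_right)
qed

text \<open>The tangent of \<open>f\<close> at the proximal point of \<open>x\<close>, whose slope
  is \<open>g\<close>, is evaluated at the proximal point of \<open>y\<close>. What remains after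
  cancellation is the square of \<open>w + \<gamma> *\<^sub>R g\<close> over
  \<open>2 * \<gamma>\<close>.\<close>

lemma moreau_env_above_tangent:
  fixes f :: "'a::euclidean_space \<Rightarrow> real"
  assumes cvx: "convex_on UNIV f" and diff: "f differentiable_on UNIV"
    and lower: "\<And>z. m \<le> f z" and "\<gamma> > 0"
  shows "moreau_env \<gamma> f x + inner ((x - prox \<gamma> f x) /\<^sub>R \<gamma>) (y - x) \<le> moreau_env \<gamma> f y"
proof -
  let ?p = "prox \<gamma> f x" and ?q = "prox \<gamma> f y"
  define g where "g = (x - ?p) /\<^sub>R \<gamma>"
  have cont: "continuous_on UNIV f" by (rule differentiable_imp_continuous_on[OF diff])
  have p: "?p = x - \<gamma> *\<^sub>R g" using \<open>\<gamma> > 0\<close> by (simp add: g_def)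
  have "GDERIV f ?p :> g"
    using GDERIV_gradient[of f ?p] diff prox_gradient[OF diff lower \<open>\<gamma> > 0\<close>, of x]
    by (simp add: g_def differentiable_on_def)
  then have tangent: "f ?p + inner g (?q - ?p) \<le> f ?q"
    by (rule convex_on_above_gradient[OF cvx])
  define w where "w = ?q - y"
  have "0 \<le> 1 / (2 * \<gamma>) * (norm (w + \<gamma> *\<^sub>R g))\<^sup>2"
    using \<open>\<gamma> > 0\<close> by simp
  also have "\<dots> = 1 / (2 * \<gamma>) * (norm w)\<^sup>2 + inner g w + \<gamma> / 2 * (norm g)\<^sup>2"
    unfolding power2_norm_eq_inner using \<open>\<gamma> > 0\<close>
    by (simp add: inner_add_left inner_add_right inner_commute field_simps)
  finally have sq: "0 \<le> 1 / (2 * \<gamma>) * (norm w)\<^sup>2 + inner g w + \<gamma> / 2 * (norm g)\<^sup>2" .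
  have "inner g (?q - ?p) = inner g w + inner g (y - x) + \<gamma> * (norm g)\<^sup>2"
    unfolding p w_def power2_norm_eq_inner by (simp add: inner_diff_right inner_add_right)
  moreover have "1 / (2 * \<gamma>) * (norm (?p - x))\<^sup>2 = \<gamma> / 2 * (norm g)\<^sup>2"
    unfolding p using \<open>\<gamma> > 0\<close> by (simp add: power_mult_distrib power2_eq_square)
  ultimately show ?thesis
    using tangent sq
    unfolding moreau_env_eq_prox[OF cont lower \<open>\<gamma> > 0\<close>] g_def[symmetric] w_def[symmetric]
    by (simp add: algebra_simps)
qed

text \<open>The envelope is squeezed between its tangent at \<open>x\<close> and that tangent plus a
  quadratic in \<open>y - x\<close>, so the remainder is of lower order.\<close>

lemma GDERIV_moreau_env:
  fixes f :: "'a::euclidean_space \<Rightarrow> real"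
  assumes cvx: "convex_on UNIV f" and diff: "f differentiable_on UNIV"
    and lower: "\<And>z. m \<le> f z" and "\<gamma> > 0"
  shows "GDERIV (moreau_env \<gamma> f) x :> (x - prox \<gamma> f x) /\<^sub>R \<gamma>"
proof -
  let ?p = "prox \<gamma> f x" and ?M = "moreau_env \<gamma> f"
  define g where "g = (x - ?p) /\<^sub>R \<gamma>"
  have p: "?p = x - \<gamma> *\<^sub>R g" using \<open>\<gamma> > 0\<close> by (simp add: g_def)
  have above: "?M y - ?M x - inner (y - x) g \<le> 1 / (2 * \<gamma>) * (norm (y - x))\<^sup>2" for y :: 'a
  proof -
    \<comment> \<open>The proximal point of \<open>x\<close> serves as a competitor in the
      minimisation at \<open>y\<close>.\<close>
    have "?M y - ?M x \<le> 1 / (2 * \<gamma>) * (norm (?p - y))\<^sup>2 - 1 / (2 * \<gamma>) * (norm (?p - x))\<^sup>2"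
      using moreau_env_le[of m f \<gamma> y ?p, OF lower \<open>\<gamma> > 0\<close>]
        moreau_env_eq_prox[OF differentiable_imp_continuous_on[OF diff] lower \<open>\<gamma> > 0\<close>, of x]
      by simp
    also have "\<dots> = inner (y - x) g + 1 / (2 * \<gamma>) * (norm (y - x))\<^sup>2"
    proof -
      define v where "v = y - x"
      have "?p - y = - (\<gamma> *\<^sub>R g + v)" "?p - x = - (\<gamma> *\<^sub>R g)"
        by (simp_all add: p v_def)
      then show ?thesis
        unfolding v_def[symmetric] using \<open>\<gamma> > 0\<close>
        by (simp only: norm_minus_cancel power2_norm_eq_inner)
          (simp add: inner_add_left inner_add_right inner_commute field_simps)
    qed
    finally show ?thesis by simp
  qed
  have below: "0 \<le> ?M y - ?M x - inner (y - x) g" for y :: 'a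
    using moreau_env_above_tangent[OF assms, of x y] by (simp add: g_def inner_commute)
  have "((\<lambda>y. (?M y - ?M x - inner (y - x) g) / norm (y - x)) \<longlongrightarrow> 0) (at x)"
  proof (rule Lim_null_comparison)
    show "\<forall>\<^sub>F y in at x. norm ((?M y - ?M x - inner (y - x) g) / norm (y - x)) \<le> 1 / (2 * \<gamma>) * norm (y - x)"
    proof (rule eventuallyI)
      fix y
      show "norm ((?M y - ?M x - inner (y - x) g) / norm (y - x)) \<le> 1 / (2 * \<gamma>) * norm (y - x)"
        using above[of y] below[of y] \<open>\<gamma> > 0\<close>
        by (cases "y = x") (simp_all add: pos_divide_le_eq power2_eq_square mult.assoc)
    qed
    show "((\<lambda>y. 1 / (2 * \<gamma>) * norm (y - x)) \<longlongrightarrow> 0) (at x)"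
      using \<open>\<gamma> > 0\<close> by (auto intro!: tendsto_eq_intros)
  qed
  then show ?thesis
    unfolding gderiv_def g_def[symmetric]
    by (simp add: has_derivative_def bounded_linear_inner_left diff_diff_eq divide_inverse_commute)
qed

section \<open>Averages, Young's inequality and affine recursions\<close>

lemma GDERIV_avg_fun:
  assumes "\<And>i. i \<in> {1..n} \<Longrightarrow> GDERIV (f i) x :> D i"
  shows "GDERIV (avg_fun n f) x :> (1 / real n) *\<^sub>R (\<Sum>i=1..n. D i)"
proof -
  have "((\<lambda>y. 1 / real n * (\<Sum>i=1..n. f i y)) has_derivative
      (\<lambda>h. 1 / real n * (\<Sum>i=1..n. inner h (D i)))) (at x)"
    by (intro has_derivative_mult_right has_derivative_sum) (use assms in \<open>simp add: gderiv_def\<close>)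
  then show ?thesis
    unfolding gderiv_def avg_fun_def by (simp add: inner_sum_right)
qed

lemma norm_avg_le:
  fixes v :: "nat \<Rightarrow> 'a::real_normed_vector"
  assumes "n \<ge> 1" "\<And>i. i \<in> {1..n} \<Longrightarrow> norm (v i) \<le> c"
  shows "norm ((1 / real n) *\<^sub>R (\<Sum>i=1..n. v i)) \<le> c"
  using sum_norm_le[of "{1..n}" v "\<lambda>_. c"] assms by (simp add: field_simps)

text \<open>Young's inequality, from expanding the square of
  \<open>s *\<^sub>R u - v\<close>.\<close>

lemma square_norm_add_le:
  fixes u v :: "'a::real_inner"
  assumes "s > 0"
  shows "(norm (u + v))\<^sup>2 \<le> (1 + s) * (norm u)\<^sup>2 + (1 + 1 / s) * (norm v)\<^sup>2"
proof -
  have "0 \<le> (norm (s *\<^sub>R u - v))\<^sup>2 / s" using assms by simp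
  also have "\<dots> = s * (norm u)\<^sup>2 - 2 * inner u v + (norm v)\<^sup>2 / s"
    unfolding power2_norm_eq_inner using assms
    by (simp add: inner_diff_left inner_diff_right inner_commute field_simps)
  finally show ?thesis
    unfolding power2_norm_eq_inner
    by (simp add: inner_add_left inner_add_right inner_commute algebra_simps)
qed

text \<open>Writing the error per step as \<open>(1 - q) * b\<close> makes \<open>b\<close> the
  fixed point of the recursion, so it passes unchanged through the induction.\<close>

lemma perturbed_contraction:
  fixes a :: "nat \<Rightarrow> real"
  assumes "\<And>k. a (Suc k) \<le> q * a k + (1 - q) * b" "0 \<le> q" "0 \<le> b"
  shows "a k \<le> q ^ k * a 0 + b"
proof (induction k)
  case (Suc k)
  have "a (Suc k) \<le> q * a k + (1 - q) * b" by (rule assms)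
  also have "\<dots> \<le> q * (q ^ k * a 0 + b) + (1 - q) * b"
    using Suc \<open>0 \<le> q\<close> by (simp add: mult_left_mono)
  finally show ?case by (simp add: algebra_simps)
qed (use assms in simp)

section \<open>One inexact gradient step\<close>

text \<open>
  With \<open>r = \<mu> / (2 L)\<close>, the exact gradient step contracts the squared distance to \<open>z\<close> by
  \<open>1 - r / 2\<close>; Young's inequality with parameter \<open>r / 4\<close> then absorbs the error.
\<close>
lemma perturbed_gradient_step:
  fixes x z :: "'a::euclidean_space"
  assumes smooth: "smooth_with L M" and "L > 0" "\<mu> > 0" "\<mu> \<le> L"
    and lower: "\<And>y. m \<le> M y"
    and tangent: "M x + inner (gradient M x) (z - x) \<le> m"
    and growth: "\<mu> / 2 * (norm (x - z))\<^sup>2 \<le> M x - m"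
    and err: "(norm e)\<^sup>2 \<le> \<epsilon>"
  shows "(norm (x - (1 / (2 * L)) *\<^sub>R (gradient M x - e) - z))\<^sup>2
    \<le> (1 - \<mu> / (8 * L)) * (norm (x - z))\<^sup>2 + (\<mu> / (8 * L)) * (20 * \<epsilon> / \<mu>\<^sup>2)"
proof -
  define \<eta> where "\<eta> = 1 / (2 * L)"
  define r where "r = \<mu> / (2 * L)"
  define G where "G = gradient M x"
  define d where "d = (norm (x - z))\<^sup>2"
  have pos: "\<eta> > 0" "0 < r" "r \<le> 1 / 2" "d \<ge> 0"
    using assms by (auto simp: \<eta>_def r_def d_def field_simps)
  have G2: "(norm G)\<^sup>2 \<le> 2 * L * (M x - m)"
    unfolding G_def by (rule smooth_with_gradient_le[OF smooth \<open>L > 0\<close> lower])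
  have "(norm ((x - z) - \<eta> *\<^sub>R G))\<^sup>2 = d - 2 * \<eta> * inner G (x - z) + \<eta> * (\<eta> * (norm G)\<^sup>2)"
    unfolding d_def power2_norm_eq_inner
    by (simp add: inner_diff_left inner_diff_right inner_commute algebra_simps)
  \<comment> \<open>Convexity gives a decrease of \<open>2 * \<eta> * (M x - m)\<close>; since
    \<open>\<eta> = 1 / (2 * L)\<close>, the squared gradient term uses up at most half of
    it.\<close>
  also have "\<dots> \<le> d - 2 * \<eta> * (M x - m) + \<eta> * (M x - m)"
  proof -
    have "M x - m \<le> inner G (x - z)" using tangent by (simp add: G_def inner_diff_right)
    then have "2 * \<eta> * (M x - m) \<le> 2 * \<eta> * inner G (x - z)" using pos by simp
    moreover have "\<eta> * (norm G)\<^sup>2 \<le> M x - m"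
      using G2 \<open>L > 0\<close> by (simp add: \<eta>_def field_simps)
    then have "\<eta> * (\<eta> * (norm G)\<^sup>2) \<le> \<eta> * (M x - m)" using pos by simp
    ultimately show ?thesis by linarith
  qed
  also have "\<dots> \<le> d - \<eta> * (\<mu> / 2 * d)"
    using mult_left_mono[OF growth[folded d_def], of \<eta>] pos by (simp add: algebra_simps)
  also have "\<dots> = (1 - r / 2) * d" by (simp add: \<eta>_def r_def algebra_simps)
  finally have exact: "(norm ((x - z) - \<eta> *\<^sub>R G))\<^sup>2 \<le> (1 - r / 2) * d" .
  have "(norm (x - \<eta> *\<^sub>R (G - e) - z))\<^sup>2 = (norm (((x - z) - \<eta> *\<^sub>R G) + \<eta> *\<^sub>R e))\<^sup>2"
    by (simp add: algebra_simps)
  also have "\<dots> \<le> (1 + r / 4) * (norm ((x - z) - \<eta> *\<^sub>R G))\<^sup>2 + (1 + 1 / (r / 4)) * (norm (\<eta> *\<^sub>R e))\<^sup>2"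
    using pos by (intro square_norm_add_le) simp
  also have "\<dots> \<le> (1 + r / 4) * ((1 - r / 2) * d) + (1 + 1 / (r / 4)) * (\<eta>\<^sup>2 * \<epsilon>)"
    using exact err pos by (intro add_mono mult_left_mono) (simp_all add: power_mult_distrib mult_left_mono)
  also have "\<dots> \<le> (1 - r / 4) * d + r / 4 * (20 * \<epsilon> / \<mu>\<^sup>2)"
  proof (rule add_mono)
    have "(1 + r / 4) * (1 - r / 2) \<le> 1 - r / 4" by (simp add: algebra_simps)
    then show "(1 + r / 4) * ((1 - r / 2) * d) \<le> (1 - r / 4) * d"
      using pos(4) by (metis mult.assoc mult_right_mono)
    have "\<epsilon> \<ge> 0" using err by (rule order_trans[rotated]) simp
    have \<eta>: "\<eta> = r / \<mu>" using \<open>\<mu> > 0\<close> by (simp add: \<eta>_def r_def)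
    have "(1 + 1 / (r / 4)) * (\<eta>\<^sup>2 * \<epsilon>) = r * (r + 4) * (\<epsilon> / \<mu>\<^sup>2)"
      unfolding \<eta> using pos(2) \<open>\<mu> > 0\<close>
      by (simp add: divide_simps power2_eq_square)
    \<comment> \<open>As \<open>r \<le> 1 / 2\<close>, \<open>r + 4\<close> is at most 5; extracting
      the factor \<open>r / 4\<close> turns 5 into 20.\<close>
    also have "\<dots> \<le> r * 5 * (\<epsilon> / \<mu>\<^sup>2)"
      using pos \<open>\<epsilon> \<ge> 0\<close> by (intro mult_right_mono mult_left_mono) auto
    finally show "(1 + 1 / (r / 4)) * (\<eta>\<^sup>2 * \<epsilon>) \<le> r / 4 * (20 * \<epsilon> / \<mu>\<^sup>2)"
      by (simp add: ac_simps)
  qed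
  finally show ?thesis by (simp add: \<eta>_def r_def G_def d_def)
qed

section \<open>Minimisers of the envelope and critical points\<close>

lemma convex_crit_min:
  assumes "convex_on UNIV f" "f differentiable_on UNIV" "gradient f z = 0"
  shows "f z \<le> f y"
  using convex_on_above_gradient[OF assms(1), of z 0 y] GDERIV_gradient[of f z] assms
  by (simp add: differentiable_on_def)

lemma moreau_env_ge_min:
  fixes f :: "'a::euclidean_space \<Rightarrow> real"
  assumes "\<And>z. m \<le> f z" "\<gamma> > 0"
  shows "m \<le> moreau_env \<gamma> f y"
  unfolding moreau_env_def using assms by (intro cINF_greatest) (auto intro: add_increasing2)

text \<open>If the envelope attains the minimum of \<open>f\<close>, the quadratic term at the
  proximal point is zero, so \<open>y\<close> is its own proximal point. Conversely, the envelope
  lies between the minimum and \<open>f y\<close>.\<close>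

lemma moreau_env_eq_min_iff:
  fixes f :: "'a::euclidean_space \<Rightarrow> real"
  assumes cvx: "convex_on UNIV f" and diff: "f differentiable_on UNIV"
    and crit: "gradient f z = 0" and "\<gamma> > 0"
  shows "moreau_env \<gamma> f y = f z \<longleftrightarrow> gradient f y = 0"
proof
  have lower: "f z \<le> f w" for w by (rule convex_crit_min[OF cvx diff crit])
  let ?p = "prox \<gamma> f y"
  show "gradient f y = 0" if "moreau_env \<gamma> f y = f z"
  proof -
    have "f ?p + 1 / (2 * \<gamma>) * (norm (?p - y))\<^sup>2 = f z"
      using that moreau_env_eq_prox[OF differentiable_imp_continuous_on[OF diff] lower \<open>\<gamma> > 0\<close>, of y]
      by simp
    moreover have "0 \<le> 1 / (2 * \<gamma>) * (norm (?p - y))\<^sup>2" using \<open>\<gamma> > 0\<close> by simp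
    ultimately have "1 / (2 * \<gamma>) * (norm (?p - y))\<^sup>2 = 0" using lower[of ?p] by linarith
    then have "?p = y" using \<open>\<gamma> > 0\<close> by simp
    then show ?thesis using prox_gradient[OF diff lower \<open>\<gamma> > 0\<close>, of y] by simp
  qed
  show "moreau_env \<gamma> f y = f z" if "gradient f y = 0"
  proof -
    have "moreau_env \<gamma> f y \<le> f y" using moreau_env_le[of "f z" f \<gamma> y y, OF lower \<open>\<gamma> > 0\<close>] by simp
    also have "\<dots> \<le> f z" by (rule convex_crit_min[OF cvx diff that])
    finally show ?thesis using moreau_env_ge_min[of "f z" f \<gamma> y, OF lower \<open>\<gamma> > 0\<close>] by simp
  qed
qed

section \<open>Convergence of inexact FedExProx\<close>

theorem theoremE1:
  fixes f :: "nat \<Rightarrow> real ^ 'd \<Rightarrow> real"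
    and Li :: "nat \<Rightarrow> real"
    and L \<gamma> \<mu> L\<gamma> \<delta> \<alpha> :: real
    and n :: nat
    and xstar :: "real ^ 'd"
    and x :: "nat \<Rightarrow> real ^ 'd"
    and p :: "nat \<Rightarrow> nat \<Rightarrow> real ^ 'd"
  assumes "n \<ge> 1"
    and closed_f: "\<And>i. i \<in> {1..n} \<Longrightarrow> closed (epigraph UNIV (f i))"
    and convex_f: "\<And>i. i \<in> {1..n} \<Longrightarrow> convex_on UNIV (f i)"
    and diff_f: "\<And>i. i \<in> {1..n} \<Longrightarrow> f i differentiable_on UNIV"
    and smooth_f: "\<And>i. i \<in> {1..n} \<Longrightarrow> smooth_with (Li i) (f i)"
    and smooth_avg: "smooth_with L (avg_fun n f)"
    and min_attained: "\<exists>z. \<forall>y. avg_fun n f z \<le> avg_fun n f y"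
    and interpolation: "\<And>i. i \<in> {1..n} \<Longrightarrow> gradient (f i) xstar = 0"
    and "\<gamma> > 0" and "\<mu> > 0"
    and PL: "\<And>y. 1 / 2 * (norm (gradient (avg_moreau n \<gamma> f) y))\<^sup>2
               \<ge> \<mu> * (avg_moreau n \<gamma> f y - avg_moreau n \<gamma> f xstar)"
    and "L\<gamma> > 0"
    and smooth_moreau: "smooth_with L\<gamma> (avg_moreau n \<gamma> f)"
    and "\<delta> \<ge> 0"
    and stepsize: "\<alpha> * \<gamma> = 1 / (2 * L\<gamma>)"
    and inexact: "\<And>k i. i \<in> {1..n} \<Longrightarrow> inexact_prox \<delta> \<gamma> (f i) (x k) (p k i)"
    and iterates: "\<And>k. x (Suc k) = x k + \<alpha> *\<^sub>R ((1 / real n) *\<^sub>R (\<Sum>i=1..n. p k i) - x k)"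
  shows "\<forall>K. (norm (x K - proj_crit n f (x K)))\<^sup>2
              \<le> (1 - \<mu> / (8 * L\<gamma>)) ^ K * (norm (x 0 - proj_crit n f (x 0)))\<^sup>2
                + 20 * \<delta> / (\<mu>\<^sup>2 * \<gamma>\<^sup>2)
           \<and> avg_fun n f (x K) - avg_fun n f (proj_crit n f (x K))
              \<le> L / 2 * (1 - \<mu> / (8 * L\<gamma>)) ^ K * (norm (x 0 - proj_crit n f (x 0)))\<^sup>2
                + 10 * L * \<delta> / (\<mu>\<^sup>2 * \<gamma>\<^sup>2)"
proof -
  define M where "M = avg_moreau n \<gamma> f"
  define X where "X = common_crit n f"
  define m where "m = M xstar"
  have lower_f: "f i xstar \<le> f i y" if "i \<in> {1..n}" for i y
    by (rule convex_crit_min[OF convex_f[OF that] diff_f[OF that] interpolation[OF that]])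
  have env_ge: "f i xstar \<le> moreau_env \<gamma> (f i) y" if "i \<in> {1..n}" for i y
    by (rule moreau_env_ge_min[OF _ \<open>\<gamma> > 0\<close>]) (rule lower_f[OF that])
  have env_eq: "moreau_env \<gamma> (f i) y = f i xstar \<longleftrightarrow> gradient (f i) y = 0" if "i \<in> {1..n}" for i y
    by (rule moreau_env_eq_min_iff[OF convex_f[OF that] diff_f[OF that] interpolation[OF that] \<open>\<gamma> > 0\<close>])
  have M_eq: "M y = 1 / real n * (\<Sum>i=1..n. moreau_env \<gamma> (f i) y)" for y
    by (simp add: M_def avg_moreau_def avg_fun_def)
  have m_eq: "m = 1 / real n * (\<Sum>i=1..n. f i xstar)"
    unfolding m_def M_eq using env_eq interpolation by (intro arg_cong2[where f = "(*)"] sum.cong) auto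
  have lower: "m \<le> M y" for y
    unfolding m_eq M_eq using env_ge by (intro mult_left_mono sum_mono) auto
  have "M y = m \<longleftrightarrow> (\<Sum>i=1..n. moreau_env \<gamma> (f i) y) = (\<Sum>i=1..n. f i xstar)" for y
    unfolding m_eq M_eq using \<open>n \<ge> 1\<close> by simp
  \<comment> \<open>Each envelope is bounded below by its own minimum \<open>f i xstar\<close>, so
    equal sums force equality term by term.\<close>
  moreover have "(\<Sum>i=1..n. moreau_env \<gamma> (f i) y) = (\<Sum>i=1..n. f i xstar)
      \<longleftrightarrow> (\<forall>i\<in>{1..n}. moreau_env \<gamma> (f i) y = f i xstar)" for y
  proof
    assume "(\<Sum>i=1..n. moreau_env \<gamma> (f i) y) = (\<Sum>i=1..n. f i xstar)"
    from sum_mono_inv[OF this[symmetric] env_ge]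
    show "\<forall>i\<in>{1..n}. moreau_env \<gamma> (f i) y = f i xstar" by simp
  qed simp
  ultimately have X_iff: "y \<in> X \<longleftrightarrow> M y = m" for y
    using env_eq by (simp add: X_def common_crit_def)
  have smooth: "smooth_with L\<gamma> M" using smooth_moreau by (simp add: M_def)
  have grad: "gradient M y = (1 / real n) *\<^sub>R (\<Sum>i=1..n. (y - prox \<gamma> (f i) y) /\<^sub>R \<gamma>)" for y
    unfolding M_def avg_moreau_def
    by (intro gradient_eqI GDERIV_avg_fun GDERIV_moreau_env[OF convex_f diff_f lower_f \<open>\<gamma> > 0\<close>])
  have tangent: "M y + inner (gradient M y) (z - y) \<le> M z" for y z
  proof -
    have "(\<Sum>i=1..n. moreau_env \<gamma> (f i) y + inner ((y - prox \<gamma> (f i) y) /\<^sub>R \<gamma>) (z - y))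
        \<le> (\<Sum>i=1..n. moreau_env \<gamma> (f i) z)"
      by (intro sum_mono moreau_env_above_tangent[OF convex_f diff_f lower_f \<open>\<gamma> > 0\<close>])
    then show ?thesis
      unfolding M_eq grad inner_scaleR_left inner_sum_left distrib_left[symmetric] sum.distrib[symmetric]
      by (intro mult_left_mono) auto
  qed
  have derM: "GDERIV M y :> gradient M y" for y by (rule smooth_with_GDERIV[OF smooth])
  have PL': "\<mu> * (M y - m) \<le> 1 / 2 * (norm (gradient M y))\<^sup>2" for y
    using PL[of y] by (simp add: M_def m_def)
  have "xstar \<in> X" by (simp add: X_iff m_def)
  then have ne: "X \<noteq> {}" by blast
  have "continuous_on UNIV M"
    using smooth by (simp add: smooth_with_def differentiable_imp_continuous_on)
  \<comment> \<open>Closedness makes \<open>closest_point\<close> a true projection; it comes from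
    viewing \<open>X\<close> as a level set of the continuous \<open>M\<close>.\<close>
  then have "closed {y. M y = m}" by (intro closed_Collect_eq continuous_intros)
  moreover have "X = {y. M y = m}" using X_iff by blast
  ultimately have cl: "closed X" by simp
  define proj where "proj = closest_point X"
  have proj_in: "proj y \<in> X" for y unfolding proj_def by (rule closest_point_in_set[OF cl ne])
  have proj_le: "norm (y - proj y) \<le> norm (y - z)" if "z \<in> X" for y z
    using closest_point_le[OF cl that, of y] by (simp add: proj_def dist_norm)
  have growth: "\<mu> / 2 * (norm (y - proj y))\<^sup>2 \<le> M y - m" for y
    by (rule PL_imp_quadratic_growth[OF derM lower PL' \<open>\<mu> > 0\<close>]) (auto simp: X_iff[symmetric] proj_le)

  \<comment> \<open>Replacing the exact proximal points by \<open>p k i\<close> in the formula for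
    the gradient of \<open>M\<close> subtracts exactly \<open>e k\<close>.\<close>
  define e where "e k = (1 / real n) *\<^sub>R (\<Sum>i=1..n. (p k i - prox \<gamma> (f i) (x k)) /\<^sub>R \<gamma>)" for k
  have step: "x (Suc k) = x k - (1 / (2 * L\<gamma>)) *\<^sub>R (gradient M (x k) - e k)" for k
  proof -
    have "\<gamma> *\<^sub>R (gradient M (x k) - e k) = (1 / real n) *\<^sub>R (\<Sum>i=1..n. x k - p k i)"
      unfolding grad e_def scaleR_diff_right[symmetric] sum_subtractf[symmetric]
      using \<open>\<gamma> > 0\<close> by (simp add: scaleR_sum_right[symmetric])
    also have "\<dots> = x k - (1 / real n) *\<^sub>R (\<Sum>i=1..n. p k i)"
      using \<open>n \<ge> 1\<close> by (simp add: sum_subtractf scaleR_diff_right sum_constant_scaleR del: sum_constant)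
    finally have "(1 / real n) *\<^sub>R (\<Sum>i=1..n. p k i) - x k = - (\<gamma> *\<^sub>R (gradient M (x k) - e k))"
      by (simp add: algebra_simps)
    then show ?thesis
      unfolding iterates by (simp only: stepsize[symmetric]) simp
  qed
  have err: "(norm (e k))\<^sup>2 \<le> \<delta> / \<gamma>\<^sup>2" for k
  proof -
    have "norm (e k) \<le> sqrt \<delta> / \<gamma>"
      unfolding e_def
    proof (rule norm_avg_le[OF \<open>n \<ge> 1\<close>])
      fix i assume "i \<in> {1..n}"
      then have "norm (p k i - prox \<gamma> (f i) (x k)) \<le> sqrt \<delta>"
        using inexact by (simp add: inexact_prox_def real_le_rsqrt)
      then show "norm ((p k i - prox \<gamma> (f i) (x k)) /\<^sub>R \<gamma>) \<le> sqrt \<delta> / \<gamma>"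
        using \<open>\<gamma> > 0\<close> by (simp add: divide_inverse_commute mult_left_mono)
    qed
    then have "(norm (e k))\<^sup>2 \<le> (sqrt \<delta> / \<gamma>)\<^sup>2" by (rule power_mono) simp
    then show ?thesis using \<open>\<delta> \<ge> 0\<close> by (simp add: power_divide)
  qed

  define a where "a k = (norm (x k - proj (x k)))\<^sup>2" for k
  define b where "b = 20 * \<delta> / (\<mu>\<^sup>2 * \<gamma>\<^sup>2)"
  have "b \<ge> 0" using \<open>\<delta> \<ge> 0\<close> by (simp add: b_def)
  have dist: "a K \<le> (1 - \<mu> / (8 * L\<gamma>)) ^ K * a 0 + b" for K
  proof (cases "X = UNIV")
    case True
    then have "a k = 0" for k using proj_le[of "x k" "x k"] by (simp add: a_def)
    with \<open>b \<ge> 0\<close> show ?thesis by simp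
  next
    case False
    then obtain y where "y \<notin> X" by blast
    then have y: "M y > m" using X_iff[of y] lower[of y] by simp
    \<comment> \<open>PL and smoothness bound the same squared gradient from both sides; dividing by
      \<open>M y - m > 0\<close> compares the constants and makes the contraction factor
      nonnegative.\<close>
    have "2 * \<mu> * (M y - m) \<le> (norm (gradient M y))\<^sup>2" using PL'[of y] by simp
    also have "\<dots> \<le> 2 * L\<gamma> * (M y - m)" by (rule smooth_with_gradient_le[OF smooth \<open>L\<gamma> > 0\<close> lower])
    finally have "\<mu> \<le> L\<gamma>" using y by simp
    show ?thesis
    proof (rule perturbed_contraction)
      show "0 \<le> 1 - \<mu> / (8 * L\<gamma>)" using \<open>\<mu> \<le> L\<gamma>\<close> \<open>L\<gamma> > 0\<close> by simp
      fix k
      \<comment> \<open>The old projection still lies in \<open>X\<close>, so measuring the new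
        iterate against it only overestimates the distance.\<close>
      have "a (Suc k) \<le> (norm (x (Suc k) - proj (x k)))\<^sup>2"
        unfolding a_def by (intro power_mono proj_le proj_in) simp
      also have "\<dots> \<le> (1 - \<mu> / (8 * L\<gamma>)) * a k + \<mu> / (8 * L\<gamma>) * (20 * (\<delta> / \<gamma>\<^sup>2) / \<mu>\<^sup>2)"
        unfolding step a_def
        using tangent[of "x k" "proj (x k)"] proj_in[of "x k"]
        by (intro perturbed_gradient_step[OF smooth \<open>L\<gamma> > 0\<close> \<open>\<mu> > 0\<close> \<open>\<mu> \<le> L\<gamma>\<close> lower _ growth err])
          (simp add: X_iff)
      finally show "a (Suc k) \<le> (1 - \<mu> / (8 * L\<gamma>)) * a k + (1 - (1 - \<mu> / (8 * L\<gamma>))) * b"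
        by (simp add: b_def mult.commute)
    qed (fact \<open>b \<ge> 0\<close>)
  qed

  have "L \<ge> 0" using smooth_avg lipschitz_on_nonneg by (auto simp: smooth_with_def)
  \<comment> \<open>All component gradients vanish at the projection, so the descent lemma for the
    average there has no linear term.\<close>
  have value_le: "avg_fun n f (x K) - avg_fun n f (proj (x K)) \<le> L / 2 * a K" for K
  proof -
    have "GDERIV (f i) (proj (x K)) :> 0" if "i \<in> {1..n}" for i
      using smooth_with_GDERIV[OF smooth_f[OF that], of "proj (x K)"] proj_in[of "x K"] that
      by (simp add: X_def common_crit_def)
    then have "gradient (avg_fun n f) (proj (x K)) = 0"
      using gradient_eqI[OF GDERIV_avg_fun[of n f "proj (x K)" "\<lambda>_. 0"]] by simp
    then show ?thesis
      using smooth_with_descent[OF smooth_avg, of "x K" "proj (x K)"] by (simp add: a_def)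
  qed
  have "L / 2 * a K \<le> L / 2 * (1 - \<mu> / (8 * L\<gamma>)) ^ K * a 0 + 10 * L * \<delta> / (\<mu>\<^sup>2 * \<gamma>\<^sup>2)" for K
    using mult_left_mono[OF dist[of K], of "L / 2"] \<open>L \<ge> 0\<close> by (simp add: b_def algebra_simps)
  with dist order_trans[OF value_le] show ?thesis
    by (simp add: proj_crit_def X_def[symmetric] proj_def[symmetric] a_def b_def)
qed

end
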